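(* Let $Z$ be a real random variable with a bounded probability density function $f_Z$ such that, for some $\alpha>2$, $$f_Z(z)=O(|z|^{-\alpha}),\qquad |z|\to\infty.$$ Then, for every real random variable $X$ independent of $Z$ whose distribution is absolutely continuous with respect to Lebesgue measure, setting $Y=X+\sigma Z$ and $\mathcal{E}_\sigma=\frac{X-\mathbb{E}[X\mid Y]}{\sigma}$ for $\sigma>0$, $$\lim_{\sigma\to0}\mathcal{E}_\sigma=\mathbb{E}[Z]-Z\qquad\text{a.s.}$$
   Context: $\mathbb{E}[X\mid Y=y]=\int x\,\mathrm{d}P_{X|Y=y}(x)$, with $P_{X|Y=y}$ the conditional distribution. Equivalently $\mathcal{E}_\sigma=\mathbb{E}[Z\mid Y]-Z$, where the version of the conditional expectation used is, for every $\sigma>0$, $$\mathbb{E}[Z\mid Y=y]=\frac{\mathbb{E}\left[\frac{y-X}{\sigma}f_Z\left(\frac{y-X}{\sigma}\right)\right]}{\mathbb{E}\left[f_Z\left(\frac{y-X}{\sigma}\right)\right]}$$ (whenever the denominator is positive); with $f_X$ the density of $X$ this equals $\mathbb{E}[Zf_X(y-\sigma Z)]/\mathbb{E}[f_X(y-\sigma Z)]$. *)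

theory Defs
  imports "HOL-Probability.Probability" "HOL-Library.Landau_Symbols"
begin

text \<open>
  For \<open>Y = X + \<sigma> Z\<close> with \<open>X\<close>, \<open>Z\<close> independent and \<open>Z\<close> with Lebesgue density \<open>f\<close>, the pair \<open>(X, Y)\<close>
  has density \<open>f ((y - x) / \<sigma>) / \<sigma>\<close> with respect to the product of the law of \<open>X\<close> and Lebesgue
  measure. Bayes' formula gives the version of the conditional law of \<open>X\<close> given \<open>Y = y\<close> below.
  A fixed version, for every \<open>\<sigma>\<close> and \<open>y\<close>, is needed since almost sure limits over
  uncountably many \<open>\<sigma>\<close> depend on the choice. Where the normalising constant vanishes, the
  kernel is the null measure.
\<close>

definition cond_law :: "'a measure \<Rightarrow> ('a \<Rightarrow> real) \<Rightarrow> (real \<Rightarrow> real) \<Rightarrow> real \<Rightarrow> real \<Rightarrow> real measure"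
  where "cond_law M X f \<sigma> y = density (distr M borel X)
    (\<lambda>x. ennreal (f ((y - x) / \<sigma>) / (\<integral>\<omega>. f ((y - X \<omega>) / \<sigma>) \<partial>M)))"

definition cond_mean :: "'a measure \<Rightarrow> ('a \<Rightarrow> real) \<Rightarrow> (real \<Rightarrow> real) \<Rightarrow> real \<Rightarrow> real \<Rightarrow> real"
  where "cond_mean M X f \<sigma> y = (\<integral>x. x \<partial>cond_law M X f \<sigma> y)"

definition scaled_error ::
    "'a measure \<Rightarrow> ('a \<Rightarrow> real) \<Rightarrow> ('a \<Rightarrow> real) \<Rightarrow> (real \<Rightarrow> real) \<Rightarrow> real \<Rightarrow> 'a \<Rightarrow> real"
  where "scaled_error M X Z f \<sigma> \<omega> = (X \<omega> - cond_mean M X f \<sigma> (X \<omega> + \<sigma> * Z \<omega>)) / \<sigma>"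

text \<open>
  The kernel disintegrates the joint law, hence is a regular conditional distribution of \<open>X\<close>
  given \<open>Y\<close>.
\<close>

lemma (in prob_space) cond_law_disintegration:
  fixes X Z :: "'a \<Rightarrow> real" and f :: "real \<Rightarrow> real" and \<sigma> C :: real
  assumes Z: "distributed M lborel Z f"
    and nonneg: "\<And>z. 0 \<le> f z" and bdd: "\<And>z. f z \<le> C"
    and indep: "indep_var borel X borel Z" and \<sigma>: "0 < \<sigma>"
    and A [measurable]: "A \<in> sets borel" and B [measurable]: "B \<in> sets borel"
  shows "emeasure M {\<omega> \<in> space M. X \<omega> \<in> A \<and> X \<omega> + \<sigma> * Z \<omega> \<in> B} =
    (\<integral>\<^sup>+y. emeasure (cond_law M X f \<sigma> y) A * indicator B y
      \<partial>distr M borel (\<lambda>\<omega>. X \<omega> + \<sigma> * Z \<omega>))"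
proof -
  have [measurable]: "random_variable borel X" "random_variable borel Z"
    using indep_var_rv1[OF indep] indep_var_rv2[OF indep] by auto
  have "(\<lambda>x. ennreal (f x)) \<in> borel_measurable lborel"
    using Z by (auto simp: distributed_def)
  then have "(\<lambda>x. enn2real (ennreal (f x))) \<in> borel_measurable borel"
    by measurable
  then have f [measurable]: "f \<in> borel_measurable borel"
    using nonneg by simp
  define P where "P = distr M borel X"
  have [measurable_cong, simp]: "sets P = sets borel" by (simp add: P_def)
  interpret P: prob_space P unfolding P_def by (rule prob_space_distr) simp
  interpret L: sigma_finite_measure lborel by (rule sigma_finite_lborel)
  interpret PL: pair_sigma_finite P "lborel :: real measure" ..
  have dZ: "distr M borel Z = density lborel f"
    using Z by (simp add: distributed_def cong: distr_cong)
  have joint: "distr M (borel \<Otimes>\<^sub>M borel) (\<lambda>\<omega>. (X \<omega>, Z \<omega>)) = P \<Otimes>\<^sub>M density lborel f"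
    using indep_var_distribution_eq[of borel X borel Z] indep dZ by (simp add: P_def)
  interpret D: prob_space "density lborel (\<lambda>x. ennreal (f x))"
    unfolding dZ[symmetric] by (rule prob_space_distr) simp
  define h where "h y = (\<integral>\<omega>. f ((y - X \<omega>) / \<sigma>) \<partial>M)" for y
  have h0: "0 \<le> h y" for y unfolding h_def using nonneg by (intro integral_nonneg_AE) auto
  have hn: "(\<integral>\<^sup>+x. f ((y - x) / \<sigma>) \<partial>P) = ennreal (h y)" for y
  proof -
    have "integrable M (\<lambda>\<omega>. f ((y - X \<omega>) / \<sigma>))"
      using nonneg bdd by (intro integrable_const_bound[where B=C]) auto
    then show ?thesis
      unfolding h_def P_def using nonneg by (simp add: nn_integral_distr nn_integral_eq_integral)
  qed
  have [measurable]: "h \<in> borel_measurable borel"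
  proof -
    have "(\<lambda>y. \<integral>\<^sup>+x. f ((y - x) / \<sigma>) \<partial>P) \<in> borel_measurable borel" by measurable
    then have "(\<lambda>y. enn2real (ennreal (h y))) \<in> borel_measurable borel"
      unfolding hn by measurable
    then show ?thesis using h0 by simp
  qed
  have key: "(\<integral>\<^sup>+\<omega>. g (X \<omega>) (X \<omega> + \<sigma> * Z \<omega>) \<partial>M) =
      (\<integral>\<^sup>+y. (\<integral>\<^sup>+x. g x y * ennreal (f ((y - x) / \<sigma>)) \<partial>P) / ennreal \<sigma> \<partial>lborel)"
    if [measurable]: "case_prod g \<in> borel_measurable (borel \<Otimes>\<^sub>M borel)"
    for g :: "real \<Rightarrow> real \<Rightarrow> ennreal"
  proof -
    have "(\<integral>\<^sup>+\<omega>. g (X \<omega>) (X \<omega> + \<sigma> * Z \<omega>) \<partial>M) =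
        (\<integral>\<^sup>+p. g (fst p) (fst p + \<sigma> * snd p) \<partial>distr M (borel \<Otimes>\<^sub>M borel) (\<lambda>\<omega>. (X \<omega>, Z \<omega>)))"
      by (subst nn_integral_distr) auto
    also have "\<dots> = (\<integral>\<^sup>+x. \<integral>\<^sup>+z. g x (x + \<sigma> * z) \<partial>density lborel f \<partial>P)"
      unfolding joint by (subst D.nn_integral_fst[symmetric]) auto
    also have "\<dots> = (\<integral>\<^sup>+x. \<integral>\<^sup>+z. ennreal (f z) * g x (x + \<sigma> * z) \<partial>lborel \<partial>P)"
      by (subst nn_integral_density) auto
    also have "\<dots> = (\<integral>\<^sup>+x. (\<integral>\<^sup>+y. g x y * ennreal (f ((y - x) / \<sigma>)) / ennreal \<sigma> \<partial>lborel) \<partial>P)"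
    proof (rule nn_integral_cong)
      fix x
      have "(\<integral>\<^sup>+y. g x y * ennreal (f ((y - x) / \<sigma>)) / ennreal \<sigma> \<partial>lborel) =
          ennreal \<bar>\<sigma>\<bar> * (\<integral>\<^sup>+z. g x (x + \<sigma> * z) * ennreal (f ((x + \<sigma> * z - x) / \<sigma>)) / ennreal \<sigma> \<partial>lborel)"
        using \<sigma> by (intro nn_integral_real_affine) auto
      also have "\<dots> = (\<integral>\<^sup>+z. ennreal (f z) * g x (x + \<sigma> * z) \<partial>lborel)"
        using \<sigma> by (subst nn_integral_cmult[symmetric])
          (auto intro!: nn_integral_cong simp: ennreal_times_divide mult.commute[of _ "g _ _"]
            mult.commute[of "ennreal \<sigma>"] ennreal_mult_divide_eq)
      finally show "(\<integral>\<^sup>+z. ennreal (f z) * g x (x + \<sigma> * z) \<partial>lborel) =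
          (\<integral>\<^sup>+y. g x y * ennreal (f ((y - x) / \<sigma>)) / ennreal \<sigma> \<partial>lborel)" ..
    qed
    also have "\<dots> = (\<integral>\<^sup>+y. (\<integral>\<^sup>+x. g x y * ennreal (f ((y - x) / \<sigma>)) / ennreal \<sigma> \<partial>P) \<partial>lborel)"
      by (rule PL.Fubini'[symmetric]) measurable
    also have "\<dots> = (\<integral>\<^sup>+y. (\<integral>\<^sup>+x. g x y * ennreal (f ((y - x) / \<sigma>)) \<partial>P) / ennreal \<sigma> \<partial>lborel)"
      by (intro nn_integral_cong nn_integral_divide) measurable
    finally show ?thesis .
  qed
  have law: "emeasure (cond_law M X f \<sigma> y) A =
      (\<integral>\<^sup>+x. ennreal (f ((y - x) / \<sigma>) / h y) * indicator A x \<partial>P)" for y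
    unfolding cond_law_def h_def[symmetric] P_def[symmetric] by (subst emeasure_density) auto
  have [measurable]: "(\<lambda>y. emeasure (cond_law M X f \<sigma> y) A) \<in> borel_measurable borel"
    unfolding law by measurable
  have "emeasure M {\<omega> \<in> space M. X \<omega> \<in> A \<and> X \<omega> + \<sigma> * Z \<omega> \<in> B} =
      (\<integral>\<^sup>+\<omega>. indicator {\<omega> \<in> space M. X \<omega> \<in> A \<and> X \<omega> + \<sigma> * Z \<omega> \<in> B} \<omega> \<partial>M)"
    by (rule nn_integral_indicator[symmetric]) measurable
  also have "\<dots> = (\<integral>\<^sup>+\<omega>. indicator A (X \<omega>) * indicator B (X \<omega> + \<sigma> * Z \<omega>) \<partial>M)"
    by (rule nn_integral_cong) (auto split: split_indicator)
  also have "\<dots> = (\<integral>\<^sup>+y. (\<integral>\<^sup>+x. indicator A x * indicator B y * ennreal (f ((y - x) / \<sigma>)) \<partial>P)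
      / ennreal \<sigma> \<partial>lborel)"
    by (rule key) measurable
  also have "\<dots> = (\<integral>\<^sup>+y. (\<integral>\<^sup>+x. (emeasure (cond_law M X f \<sigma> y) A * indicator B y) *
      ennreal (f ((y - x) / \<sigma>)) \<partial>P) / ennreal \<sigma> \<partial>lborel)"
  proof (rule nn_integral_cong)
    fix y :: real
    have 1: "(\<integral>\<^sup>+x. indicator A x * indicator B y * ennreal (f ((y - x) / \<sigma>)) \<partial>P) =
        indicator B y * (\<integral>\<^sup>+x. ennreal (f ((y - x) / \<sigma>)) * indicator A x \<partial>P)"
      by (subst nn_integral_cmult[symmetric]) (auto intro!: nn_integral_cong simp: ac_simps)
    have 2: "(\<integral>\<^sup>+x. (emeasure (cond_law M X f \<sigma> y) A * indicator B y) *
        ennreal (f ((y - x) / \<sigma>)) \<partial>P) =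
        indicator B y * (emeasure (cond_law M X f \<sigma> y) A * ennreal (h y))"
      by (subst nn_integral_cmult) (auto simp: hn ac_simps)
    have 3: "(\<integral>\<^sup>+x. ennreal (f ((y - x) / \<sigma>)) * indicator A x \<partial>P) =
        emeasure (cond_law M X f \<sigma> y) A * ennreal (h y)"
    proof (cases "h y = 0")
      case True
      have "(\<integral>\<^sup>+x. ennreal (f ((y - x) / \<sigma>)) * indicator A x \<partial>P) \<le> (\<integral>\<^sup>+x. f ((y - x) / \<sigma>) \<partial>P)"
        by (intro nn_integral_mono) (auto simp: indicator_def)
      with True show ?thesis by (simp add: hn)
    next
      case False
      then have hp: "0 < h y" using h0[of y] by simp
      have "emeasure (cond_law M X f \<sigma> y) A * ennreal (h y) =
          (\<integral>\<^sup>+x. ennreal (f ((y - x) / \<sigma>) / h y) * indicator A x * ennreal (h y) \<partial>P)"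
        unfolding law by (rule nn_integral_multc[symmetric]) measurable
      also have "\<dots> = (\<integral>\<^sup>+x. ennreal (f ((y - x) / \<sigma>)) * indicator A x \<partial>P)"
        using hp nonneg by (intro nn_integral_cong)
          (auto simp: indicator_def ennreal_mult'[symmetric])
      finally show ?thesis ..
    qed
    show "(\<integral>\<^sup>+x. indicator A x * indicator B y * ennreal (f ((y - x) / \<sigma>)) \<partial>P) / ennreal \<sigma> =
        (\<integral>\<^sup>+x. (emeasure (cond_law M X f \<sigma> y) A * indicator B y) *
          ennreal (f ((y - x) / \<sigma>)) \<partial>P) / ennreal \<sigma>"
      unfolding 1 2 3 ..
  qed
  also have "\<dots> = (\<integral>\<^sup>+\<omega>. emeasure (cond_law M X f \<sigma> (X \<omega> + \<sigma> * Z \<omega>)) A *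
      indicator B (X \<omega> + \<sigma> * Z \<omega>) \<partial>M)"
    by (rule key[symmetric]) measurable
  also have "\<dots> = (\<integral>\<^sup>+y. emeasure (cond_law M X f \<sigma> y) A * indicator B y
      \<partial>distr M borel (\<lambda>\<omega>. X \<omega> + \<sigma> * Z \<omega>))"
    by (subst nn_integral_distr) auto
  finally show ?thesis .
qed

lemma bounded_moment_of_tail:
  fixes f :: "real \<Rightarrow> real"
  assumes "bounded (range f)" and "1 \<le> \<alpha>"
    and "f \<in> O[at_infinity](\<lambda>z. \<bar>z\<bar> powr (- \<alpha>))"
  obtains K where "\<And>z. \<bar>z * f z\<bar> \<le> K"
proof -
  obtain C where C: "\<And>z. \<bar>f z\<bar> \<le> C"
    using assms(1) by (auto simp: bounded_iff)
  obtain c where c: "c > 0" "\<forall>\<^sub>F z in at_infinity. norm (f z) \<le> c * norm (\<bar>z\<bar> powr (- \<alpha>))"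
    using landau_o.bigE[OF assms(3)] by blast
  then obtain b where b: "\<And>z. b \<le> \<bar>z\<bar> \<Longrightarrow> \<bar>f z\<bar> \<le> c * \<bar>z\<bar> powr (- \<alpha>)"
    by (auto simp: eventually_at_infinity)
  define R where "R = max 1 b"
  have "\<bar>z * f z\<bar> \<le> max c (R * C)" for z
  proof (cases "R \<le> \<bar>z\<bar>")
    case True
    then have z: "1 \<le> \<bar>z\<bar>" "b \<le> \<bar>z\<bar>" by (auto simp: R_def)
    have "\<bar>z * f z\<bar> \<le> \<bar>z\<bar> * (c * \<bar>z\<bar> powr (- \<alpha>))"
      unfolding abs_mult by (intro mult_left_mono b z) auto
    also have "\<dots> = c * \<bar>z\<bar> powr (1 - \<alpha>)"
      using z by (simp add: powr_diff powr_minus field_simps)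
    also have "\<dots> \<le> c * \<bar>z\<bar> powr 0"
      using z c assms(2) by (intro mult_left_mono powr_mono) auto
    also have "\<dots> \<le> c" using z c by simp
    finally show ?thesis by simp
  next
    case False
    then have "\<bar>z * f z\<bar> \<le> R * C"
      unfolding abs_mult using C[of z] by (intro mult_mono) auto
    then show ?thesis by simp
  qed
  then show ?thesis by (rule that)
qed

text \<open>
  Writing \<open>X = Y - \<sigma> Z\<close>, the error is \<open>E[Z | Y] - Z\<close>, also if \<open>X\<close> itself is not integrable.
\<close>

lemma (in prob_space) scaled_error_eq:
  fixes X Z :: "'a \<Rightarrow> real" and f :: "real \<Rightarrow> real" and \<sigma> \<alpha> :: real
  assumes X [measurable]: "random_variable borel X"
    and f [measurable]: "f \<in> borel_measurable borel"
    and nonneg: "\<And>z. 0 \<le> f z" and bdd: "bounded (range f)"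
    and tail: "f \<in> O[at_infinity](\<lambda>z. \<bar>z\<bar> powr (- \<alpha>))" and \<alpha>: "2 < \<alpha>"
    and \<sigma>: "0 < \<sigma>" and y: "y = X \<omega> + \<sigma> * Z \<omega>"
    and pos: "0 < expectation (\<lambda>\<omega>. f ((y - X \<omega>) / \<sigma>))"
  shows "prob_space (cond_law M X f \<sigma> y)"
    and "integrable (cond_law M X f \<sigma> y) (\<lambda>x. x)"
    and "scaled_error M X Z f \<sigma> \<omega> =
      expectation (\<lambda>\<omega>. (y - X \<omega>) / \<sigma> * f ((y - X \<omega>) / \<sigma>)) /
      expectation (\<lambda>\<omega>. f ((y - X \<omega>) / \<sigma>)) - Z \<omega>"
proof -
  define h where "h = expectation (\<lambda>\<omega>. f ((y - X \<omega>) / \<sigma>))"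
  have h: "0 < h" using pos by (simp add: h_def)
  obtain C where C: "\<And>z. \<bar>f z\<bar> \<le> C"
    using bdd by (auto simp: bounded_iff)
  obtain K where K: "\<And>z. \<bar>z * f z\<bar> \<le> K"
    using bounded_moment_of_tail[OF bdd _ tail] \<alpha> by auto
  have i0: "integrable M (\<lambda>\<omega>. f ((y - X \<omega>) / \<sigma>))"
    using C by (intro integrable_const_bound[where B=C]) auto
  have i1: "integrable M (\<lambda>\<omega>. (y - X \<omega>) / \<sigma> * f ((y - X \<omega>) / \<sigma>))"
    using K[of "(y - X \<omega>) / \<sigma>" for \<omega>] by (intro integrable_const_bound[where B=K]) auto
  have eq: "f ((y - X \<omega>) / \<sigma>) / h * X \<omega> =
      y / h * f ((y - X \<omega>) / \<sigma>) - \<sigma> / h * ((y - X \<omega>) / \<sigma> * f ((y - X \<omega>) / \<sigma>))" for \<omega>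
    using \<sigma> h by (simp add: field_simps)
  have i2: "integrable M (\<lambda>\<omega>. f ((y - X \<omega>) / \<sigma>) / h * X \<omega>)"
    unfolding eq by (intro Bochner_Integration.integrable_diff integrable_mult_right i0 i1)
  show "prob_space (cond_law M X f \<sigma> y)"
  proof
    have "emeasure (cond_law M X f \<sigma> y) (space (cond_law M X f \<sigma> y)) =
        (\<integral>\<^sup>+\<omega>. ennreal (f ((y - X \<omega>) / \<sigma>) / h) \<partial>M)"
      unfolding cond_law_def h_def[symmetric] by (simp add: emeasure_density nn_integral_distr)
    also have "\<dots> = ennreal (expectation (\<lambda>\<omega>. f ((y - X \<omega>) / \<sigma>) / h))"
      using h nonneg i0 by (intro nn_integral_eq_integral) auto
    also have "\<dots> = 1" using h by (simp add: h_def)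
    finally show "emeasure (cond_law M X f \<sigma> y) (space (cond_law M X f \<sigma> y)) = 1" .
  qed
  show "integrable (cond_law M X f \<sigma> y) (\<lambda>x. x)"
    unfolding cond_law_def h_def[symmetric] using h nonneg i2
    by (subst integrable_density) (auto simp: integrable_distr_eq)
  have "cond_mean M X f \<sigma> y = expectation (\<lambda>\<omega>. f ((y - X \<omega>) / \<sigma>) / h * X \<omega>)"
    unfolding cond_mean_def cond_law_def h_def[symmetric] using h nonneg
    by (subst integral_density) (auto simp: integral_distr)
  also have "\<dots> = y / h * h - \<sigma> / h * expectation (\<lambda>\<omega>. (y - X \<omega>) / \<sigma> * f ((y - X \<omega>) / \<sigma>))"
    unfolding eq by (subst Bochner_Integration.integral_diff)
      (intro integrable_mult_right i0 i1 | simp only: integral_mult_right_zero h_def)+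
  finally have "cond_mean M X f \<sigma> y =
      y - \<sigma> / h * expectation (\<lambda>\<omega>. (y - X \<omega>) / \<sigma> * f ((y - X \<omega>) / \<sigma>))"
    using h by simp
  then have "scaled_error M X Z f \<sigma> \<omega> = (X \<omega> -
      (X \<omega> + \<sigma> * Z \<omega> - \<sigma> / h * expectation (\<lambda>\<omega>. (y - X \<omega>) / \<sigma> * f ((y - X \<omega>) / \<sigma>)))) / \<sigma>"
    unfolding scaled_error_def y[symmetric] using y by simp
  then show "scaled_error M X Z f \<sigma> \<omega> =
      expectation (\<lambda>\<omega>. (y - X \<omega>) / \<sigma> * f ((y - X \<omega>) / \<sigma>)) /
      expectation (\<lambda>\<omega>. f ((y - X \<omega>) / \<sigma>)) - Z \<omega>"
    unfolding h_def[symmetric] using \<sigma> h by (simp add: field_simps)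
qed

end

theory Submission
  imports Defs
begin

text \<open>
  Let \<open>g\<close> be a density of \<open>X\<close>. After the substitution \<open>x = y - \<sigma> z\<close>, the error is
  \<open>N / D - Z\<close> with \<open>N = \<integral> z f(z) g(y - \<sigma> z) dz\<close>, \<open>D = \<integral> f(z) g(y - \<sigma> z) dz\<close> and
  \<open>y = X + \<sigma> Z\<close>. Since \<open>\<alpha> > 2\<close>, both kernels \<open>f(z)\<close> and \<open>z f(z)\<close>, shifted by the fixed
  amount \<open>Z\<close>, have integrable radially decreasing majorants, so at every Lebesgue point of \<open>g\<close>
  the two integrals converge to \<open>g(X) E[Z]\<close> and \<open>g(X)\<close>. Almost surely \<open>X\<close> is a Lebesgue
  point of \<open>g\<close> with \<open>g(X) > 0\<close>.
\<close>

section \<open>Lebesgue points on the real line\<close>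

text \<open>The differentiation theorem for the gauge integral, moved to integrals over
  \<open>lborel\<close>. Its averages run over boxes with lower corner \<open>x\<close>, hence the
  one-sided window.\<close>

lemma AE_tendsto_right_average:
  fixes g :: "real \<Rightarrow> real"
  assumes "\<And>a b. set_integrable lborel {a..b} g"
  shows "AE x in lborel. ((\<lambda>h. (LINT t:{x..x+h}|lborel. g t) / h) \<longlongrightarrow> g x) (at_right 0)"
proof -
  have "g integrable_on cbox a b" for a b
    using set_borel_integral_eq_integral(1)[OF assms] by simp
  then obtain N where N: "negligible N"
    and *: "\<And>x e. x \<notin> N \<Longrightarrow> 0 < e \<Longrightarrow> \<exists>d>0. \<forall>h. 0 < h \<and> h < d \<longrightarrow>
      norm (integral (cbox x (x + h *\<^sub>R One)) g /\<^sub>R h ^ DIM(real) - g x) < e"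
    using integrable_ccontinuous_explicit[of g] by metis
  have lim: "((\<lambda>h. (LINT t:{x..x+h}|lborel. g t) / h) \<longlongrightarrow> g x) (at_right 0)" if "x \<notin> N" for x
  proof (rule tendstoI)
    fix e :: real assume "0 < e"
    from *[OF \<open>x \<notin> N\<close> this] obtain d where d: "d > 0"
      and dd: "\<And>h. 0 < h \<Longrightarrow> h < d \<Longrightarrow> \<bar>integral {x..x+h} g / h - g x\<bar> < e"
      by (auto simp: divide_inverse mult.commute)
    show "\<forall>\<^sub>F h in at_right 0. dist ((LINT t:{x..x+h}|lborel. g t) / h) (g x) < e"
      using d dd set_borel_integral_eq_integral(2)[OF assms]
      by (auto simp: eventually_at_right_field dist_real_def)
  qed
  \<comment> \<open>\<open>N\<close> is only Lebesgue negligible, perhaps not Borel, so the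
    statement passes through the completion of \<open>lborel\<close>.\<close>
  from N have "N \<in> null_sets lebesgue" by (simp add: negligible_iff_null_sets)
  then have "AE x in lebesgue. x \<notin> N" by (rule AE_not_in)
  then have "AE x in lborel. x \<notin> N" using AE_completion_iff by blast
  then show ?thesis by eventually_elim (rule lim)
qed

lemma set_integrable_abs_diff_const:
  fixes g :: "real \<Rightarrow> real"
  assumes "set_integrable lborel {a..b} g"
  shows "set_integrable lborel {a..b} (\<lambda>t. \<bar>g t - c\<bar>)"
  by (intro set_integrable_abs set_integral_diff assms borel_integrable_atLeastAtMost') auto

lemma AE_right_lebesgue_point:
  fixes g :: "real \<Rightarrow> real"
  assumes g: "\<And>a b. set_integrable lborel {a..b} g"
  shows "AE x in lborel. ((\<lambda>h. (LINT t:{x..x+h}|lborel. \<bar>g t - g x\<bar>) / h) \<longlongrightarrow> 0) (at_right 0)"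
proof -
  have int: "set_integrable lborel {a..b} (\<lambda>t. \<bar>g t - c\<bar>)" for a b c
    by (intro set_integrable_abs_diff_const g)
  \<comment> \<open>\<open>g x\<close> varies with \<open>x\<close>, so the averages are first differentiated for \<open>\<bar>g - q\<bar>\<close> with the countably many rational \<open>q\<close>.\<close>
  have "AE x in lborel. \<forall>q\<in>\<rat>. ((\<lambda>h. (LINT t:{x..x+h}|lborel. \<bar>g t - q\<bar>) / h) \<longlongrightarrow> \<bar>g x - q\<bar>) (at_right 0)"
    by (intro AE_ball_countable' AE_tendsto_right_average int countable_rat)
  then show ?thesis
  proof eventually_elim
    fix x
    assume q: "\<forall>q\<in>\<rat>. ((\<lambda>h. (LINT t:{x..x+h}|lborel. \<bar>g t - q\<bar>) / h) \<longlongrightarrow> \<bar>g x - q\<bar>) (at_right 0)"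
    show "((\<lambda>h. (LINT t:{x..x+h}|lborel. \<bar>g t - g x\<bar>) / h) \<longlongrightarrow> 0) (at_right 0)"
    proof (rule tendstoI)
      fix e :: real assume e: "0 < e"
      obtain q where q': "q \<in> \<rat>" "\<bar>g x - q\<bar> < e/3"
      proof -
        from Rats_dense_in_real[of "g x - e/3" "g x + e/3"] e
        obtain r where "r \<in> \<rat>" "g x - e/3 < r" "r < g x + e/3" by auto
        then show thesis by (intro that[of r]) linarith+
      qed
      \<comment> \<open>These averages tend to \<open>\<bar>g x - q\<bar> < e/3\<close>, which
        leaves room below \<open>e/2\<close>. Replacing \<open>q\<close> by \<open>g x\<close>
        inside the average costs at most another \<open>e/3\<close>.\<close>
      have "\<forall>\<^sub>F h in at_right 0. (LINT t:{x..x+h}|lborel. \<bar>g t - q\<bar>) / h < e/2"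
        using q q' e by (intro order_tendstoD(2)) auto
      moreover have "\<forall>\<^sub>F h in at_right (0::real). 0 < h" by (rule eventually_at_right_less)
      ultimately show "\<forall>\<^sub>F h in at_right 0. dist ((LINT t:{x..x+h}|lborel. \<bar>g t - g x\<bar>) / h) 0 < e"
      proof eventually_elim
        case (elim h)
        have cI: "set_integrable lborel {x..x+h} (\<lambda>t. \<bar>q - g x\<bar>)"
          by (intro borel_integrable_atLeastAtMost') auto
        have "(LINT t:{x..x+h}|lborel. \<bar>g t - g x\<bar>) \<le> (LINT t:{x..x+h}|lborel. \<bar>g t - q\<bar> + \<bar>q - g x\<bar>)"
          by (intro set_integral_mono int set_integral_add cI) auto
        also have "\<dots> = (LINT t:{x..x+h}|lborel. \<bar>g t - q\<bar>) + h * \<bar>q - g x\<bar>"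
          using elim(2) by (subst set_integral_add(2)[OF int cI]) (simp add: set_lebesgue_integral_def)
        finally have "(LINT t:{x..x+h}|lborel. \<bar>g t - g x\<bar>) / h \<le>
            ((LINT t:{x..x+h}|lborel. \<bar>g t - q\<bar>) + h * \<bar>q - g x\<bar>) / h"
          using elim(2) by (intro divide_right_mono) auto
        also have "\<dots> = (LINT t:{x..x+h}|lborel. \<bar>g t - q\<bar>) / h + \<bar>q - g x\<bar>"
          using elim(2) by (simp add: add_divide_distrib)
        also have "\<dots> < e"
          using elim(1) q'(2) e abs_minus_commute[of q "g x"] by linarith
        finally have "(LINT t:{x..x+h}|lborel. \<bar>g t - g x\<bar>) / h < e" .
        moreover have "0 \<le> (LINT t:{x..x+h}|lborel. \<bar>g t - g x\<bar>)"
          unfolding set_lebesgue_integral_def by (intro integral_nonneg_AE) auto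
        ultimately show ?case using elim by simp
      qed
    qed
  qed
qed

text \<open>The left half of the window around \<open>x\<close> is the right half of the window
  around \<open>-x\<close> for the reflected function, so the one-sided result is used for both.
  Dividing by \<open>h\<close> instead of the length \<open>2 * h\<close> is harmless for a limit
  equal to 0.\<close>

lemma AE_lebesgue_point:
  fixes g :: "real \<Rightarrow> real"
  assumes g: "\<And>a b. set_integrable lborel {a..b} g"
  shows "AE x in lborel. ((\<lambda>h. (LINT t:{x-h..x+h}|lborel. \<bar>g t - g x\<bar>) / h) \<longlongrightarrow> 0) (at_right 0)"
proof -
  have refl: "(LINT t:{a..b}|lborel. F t) = (LINT t:{-b..-a}|lborel. F (- t))" for a b and F :: "real \<Rightarrow> real"
    by (subst set_integral_reflect) (auto intro!: arg_cong2[where f="set_lebesgue_integral lborel"])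
  have g': "set_integrable lborel {a..b} (\<lambda>t. g (- t))" for a b
  proof -
    have "integrable lborel (\<lambda>t. indicator {-b..-a} (0 + (-1) * t) *\<^sub>R g (0 + (-1) * t))"
      using g[of "-b" "-a"] unfolding set_integrable_def by (rule lborel_integrable_real_affine) simp
    then show ?thesis unfolding set_integrable_def
      by (rule Bochner_Integration.integrable_cong[THEN iffD1, rotated -1]) (auto simp: indicator_def)
  qed
  have int: "set_integrable lborel {a..b} (\<lambda>t. \<bar>g t - c\<bar>)" for a b c
    by (intro set_integrable_abs_diff_const g)
  have "AE x in lborel. ((\<lambda>h. (LINT t:{-x..-x+h}|lborel. \<bar>g (-t) - g x\<bar>) / h) \<longlongrightarrow> 0) (at_right 0)"
  proof -
    \<comment> \<open>Lebesgue measure is its own image under \<open>uminus\<close>, so the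
      exceptional null set may be reflected from \<open>-x\<close> back to \<open>x\<close>.\<close>
    have "AE x in distr lborel borel uminus. ((\<lambda>h. (LINT t:{x..x+h}|lborel. \<bar>g (-t) - g (-x)\<bar>) / h) \<longlongrightarrow> 0) (at_right 0)"
      unfolding lborel_distr_uminus using AE_right_lebesgue_point[OF g'] .
    from AE_distrD[OF _ this] show ?thesis by simp
  qed
  with AE_right_lebesgue_point[OF g] show ?thesis
  proof eventually_elim
    fix x
    assume 1: "((\<lambda>h. (LINT t:{x..x+h}|lborel. \<bar>g t - g x\<bar>) / h) \<longlongrightarrow> 0) (at_right 0)"
      and 2: "((\<lambda>h. (LINT t:{-x..-x+h}|lborel. \<bar>g (-t) - g x\<bar>) / h) \<longlongrightarrow> 0) (at_right 0)"
    have "\<forall>\<^sub>F h in at_right (0::real). (LINT t:{x..x+h}|lborel. \<bar>g t - g x\<bar>) / h +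
        (LINT t:{-x..-x+h}|lborel. \<bar>g (-t) - g x\<bar>) / h = (LINT t:{x-h..x+h}|lborel. \<bar>g t - g x\<bar>) / h"
      using eventually_at_right_less
    proof eventually_elim
      fix h :: real assume "0 < h"
      then have u: "{x-h..x+h} = {x-h..x} \<union> {x..x+h}" by auto
      \<comment> \<open>The two halves overlap only in the point \<open>x\<close>, a null
        set.\<close>
      have "AE t in lborel. \<not> (t \<in> {x-h..x} \<and> t \<in> {x..x+h})"
        using AE_lborel_singleton[of x] by eventually_elim auto
      then have "(LINT t:{x-h..x+h}|lborel. \<bar>g t - g x\<bar>) =
          (LINT t:{x-h..x}|lborel. \<bar>g t - g x\<bar>) + (LINT t:{x..x+h}|lborel. \<bar>g t - g x\<bar>)"
        unfolding u by (intro set_integral_Un_AE int) auto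
      also have "(LINT t:{x-h..x}|lborel. \<bar>g t - g x\<bar>) = (LINT t:{-x..-x+h}|lborel. \<bar>g (-t) - g x\<bar>)"
        by (subst refl) simp
      finally show "(LINT t:{x..x+h}|lborel. \<bar>g t - g x\<bar>) / h +
        (LINT t:{-x..-x+h}|lborel. \<bar>g (-t) - g x\<bar>) / h = (LINT t:{x-h..x+h}|lborel. \<bar>g t - g x\<bar>) / h"
        by (simp add: add_divide_distrib)
    qed
    from Lim_transform_eventually[OF tendsto_add[OF 1 2] this]
    show "((\<lambda>h. (LINT t:{x-h..x+h}|lborel. \<bar>g t - g x\<bar>) / h) \<longlongrightarrow> 0) (at_right 0)" by simp
  qed
qed

section \<open>Dyadic estimates for kernels with power decay\<close>

text \<open>The decreasing majorant is dominated by a geometric combination of indicators of dyadic intervals.\<close>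

lemma dyadic_majorant:
  fixes \<phi> :: "real \<Rightarrow> real" and F :: "real \<Rightarrow> ennreal"
  assumes F [measurable]: "F \<in> borel_measurable borel" and "0 \<le> K" "0 \<le> \<beta>"
    and \<phi>: "\<And>w. \<bar>\<phi> w\<bar> \<le> K * max 1 \<bar>w\<bar> powr (- \<beta>)"
  shows "(\<integral>\<^sup>+w. ennreal \<bar>\<phi> w\<bar> * F w \<partial>lborel) \<le>
    (\<Sum>k. ennreal (K * 2 powr \<beta> * (2 powr (- \<beta>)) ^ k) * (\<integral>\<^sup>+w\<in>{- (2 ^ k)..2 ^ k}. F w \<partial>lborel))"
proof -
  \<comment> \<open>At scale \<open>k\<close> only
    \<open>max 1 \<bar>w\<bar> \<ge> 2 powr (k - 1)\<close> is known. The factor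
    \<open>2 powr \<beta>\<close> pays for this shift by one.\<close>
  define c where "c k = K * 2 powr \<beta> * (2 powr (- \<beta>)) ^ k" for k :: nat
  have pt: "ennreal \<bar>\<phi> w\<bar> \<le> (\<Sum>k. ennreal (c k) * indicator {- (2 ^ k)..2 ^ k} w)" for w
  proof -
    define k where "k = (LEAST k::nat. \<bar>w\<bar> \<le> 2 ^ k)"
    obtain n where "\<bar>w\<bar> < 2 ^ n" using real_arch_pow[of 2 "\<bar>w\<bar>"] by auto
    then have "\<bar>w\<bar> \<le> 2 ^ n" by simp
    then have wk: "\<bar>w\<bar> \<le> 2 ^ k" unfolding k_def by (rule LeastI)
    \<comment> \<open>Minimality of \<open>k\<close> gives
      \<open>2 ^ (k - 1) < \<bar>w\<bar>\<close>, except for \<open>k = 0\<close>, where the entry 1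
      of the maximum exceeds \<open>1/2\<close>.\<close>
    have "2 powr (real k - 1) \<le> max 1 \<bar>w\<bar>"
    proof (cases k)
      case 0 then show ?thesis by (simp add: powr_minus)
    next
      case (Suc j)
      then have "\<not> \<bar>w\<bar> \<le> 2 ^ j" using not_less_Least[of j "\<lambda>k. \<bar>w\<bar> \<le> 2 ^ k"] by (simp add: k_def)
      then show ?thesis using Suc by (simp add: powr_realpow)
    qed
    then have "max 1 \<bar>w\<bar> powr (- \<beta>) \<le> (2 powr (real k - 1)) powr (- \<beta>)"
      using assms by (intro powr_mono2') auto
    also have "\<dots> = 2 powr \<beta> * (2 powr (- \<beta>)) ^ k"
      by (simp add: powr_powr powr_realpow[symmetric] powr_add[symmetric] algebra_simps)
    finally have "\<bar>\<phi> w\<bar> \<le> c k"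
      unfolding c_def mult.assoc using \<phi>[of w] \<open>0 \<le> K\<close> by (meson mult_left_mono order_trans)
    then have "ennreal \<bar>\<phi> w\<bar> \<le> (\<Sum>k\<in>{k}. ennreal (c k) * indicator {- (2 ^ k)..2 ^ k} w)"
      using wk by (auto simp: indicator_def abs_le_iff intro!: ennreal_leI)
    also have "\<dots> \<le> (\<Sum>k. ennreal (c k) * indicator {- (2 ^ k)..2 ^ k} w)"
      by (intro sum_le_suminf) auto
    finally show ?thesis .
  qed
  have "(\<integral>\<^sup>+w. ennreal \<bar>\<phi> w\<bar> * F w \<partial>lborel) \<le>
      (\<integral>\<^sup>+w. (\<Sum>k. ennreal (c k) * (F w * indicator {- (2 ^ k)..2 ^ k} w)) \<partial>lborel)"
  proof (rule nn_integral_mono)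
    fix w
    have "ennreal \<bar>\<phi> w\<bar> * F w \<le> (\<Sum>k. ennreal (c k) * indicator {- (2 ^ k)..2 ^ k} w) * F w"
      by (intro mult_right_mono pt) simp
    also have "\<dots> = (\<Sum>k. ennreal (c k) * (F w * indicator {- (2 ^ k)..2 ^ k} w))"
      by (subst ennreal_suminf_multc[symmetric]) (simp add: ac_simps)
    finally show "ennreal \<bar>\<phi> w\<bar> * F w \<le> (\<Sum>k. ennreal (c k) * (F w * indicator {- (2 ^ k)..2 ^ k} w))" .
  qed
  also have "\<dots> = (\<Sum>k. ennreal (c k) * (\<integral>\<^sup>+w\<in>{- (2 ^ k)..2 ^ k}. F w \<partial>lborel))"
    by (subst nn_integral_suminf) (auto simp: nn_integral_cmult)
  finally show ?thesis unfolding c_def .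
qed

text \<open>The dyadic bound with \<open>F = 1\<close>: the interval at scale \<open>k\<close> has
  length \<open>2 * 2 ^ k\<close>, so the series is geometric with ratio
  \<open>2 powr (1 - \<beta>)\<close>, which is below 1 exactly for
  \<open>\<beta> > 1\<close>.\<close>

lemma powr_tail_lborel_integrable:
  fixes \<phi> :: "real \<Rightarrow> real"
  assumes [measurable]: "\<phi> \<in> borel_measurable borel" and K: "0 \<le> K" and \<beta>: "1 < \<beta>"
    and \<phi>: "\<And>w. \<bar>\<phi> w\<bar> \<le> K * max 1 \<bar>w\<bar> powr (- \<beta>)"
  shows "integrable lborel \<phi>"
proof -
  define q :: real where "q = 2 * 2 powr (- \<beta>)"
  have q: "0 \<le> q" "q < 1"
    using \<beta> powr_less_mono[of 1 \<beta> "2::real"] by (auto simp: q_def powr_minus field_simps)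
  have "(\<integral>\<^sup>+w. ennreal \<bar>\<phi> w\<bar> * 1 \<partial>lborel) \<le>
    (\<Sum>k. ennreal (K * 2 powr \<beta> * (2 powr (- \<beta>)) ^ k) * (\<integral>\<^sup>+w\<in>{- (2 ^ k)..(2::real) ^ k}. 1 \<partial>lborel))"
    using assms by (intro dyadic_majorant) auto
  also have "\<dots> = (\<Sum>k. ennreal (K * 2 powr \<beta> * 2 * q ^ k))"
    using K by (intro suminf_cong) (simp add: ennreal_mult'[symmetric] q_def power_mult_distrib mult_ac)
  also have "\<dots> = ennreal (\<Sum>k. K * 2 powr \<beta> * 2 * q ^ k)"
    using q K by (intro suminf_ennreal2 summable_mult summable_geometric) auto
  finally show ?thesis
    by (intro integrableI_bounded) (auto simp: top.not_eq_extremum[symmetric] top_unique)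
qed

text \<open>In the application \<open>D t\<close> is the deviation of \<open>g\<close> from its
  value at a Lebesgue point, at distance \<open>t\<close>, and \<open>a r\<close> is its integral
  over \<open>{- r..r}\<close> divided by \<open>r\<close>. After rescaling, the dyadic term at
  scale \<open>k\<close> is at most a constant times \<open>q ^ k * a (\<sigma> * 2 ^ k)\<close>,
  and this series is passed to the limit termwise.\<close>

lemma tendsto_nn_integral_concentrating:
  fixes \<phi> D a :: "real \<Rightarrow> real"
  assumes [measurable]: "D \<in> borel_measurable borel"
    and K: "0 \<le> K" and \<beta>: "1 < \<beta>"
    and \<phi>: "\<And>w. \<bar>\<phi> w\<bar> \<le> K * max 1 \<bar>w\<bar> powr (- \<beta>)"
    and D: "\<And>r. 0 < r \<Longrightarrow> (\<integral>\<^sup>+t\<in>{- r..r}. ennreal (D t) \<partial>lborel) \<le> ennreal (r * a r)"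
    and a0: "\<And>r. 0 < r \<Longrightarrow> 0 \<le> a r" and B: "\<And>r. 0 < r \<Longrightarrow> a r \<le> B"
    and lim: "(a \<longlongrightarrow> 0) (at_right 0)"
  shows "((\<lambda>\<sigma>. \<integral>\<^sup>+w. ennreal \<bar>\<phi> w\<bar> * ennreal (D (\<sigma> * w)) \<partial>lborel) \<longlongrightarrow> 0) (at_right 0)"
proof -
  define q :: real where "q = 2 * 2 powr (- \<beta>)"
  have q: "0 \<le> q" "q < 1"
    using \<beta> powr_less_mono[of 1 \<beta> "2::real"] by (auto simp: q_def powr_minus field_simps)
  define C where "C = K * 2 powr \<beta>"
  have C: "0 \<le> C" using K by (simp add: C_def)
  have pos: "\<forall>\<^sub>F \<sigma> in at_right (0::real). 0 < \<sigma>" by (rule eventually_at_right_less)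
  have summ: "summable (\<lambda>k. C * q ^ k * B)"
    using q by (intro summable_mult summable_mult2 summable_geometric) auto
  have le: "C * q ^ k * a (\<sigma> * 2 ^ k) \<le> C * q ^ k * B" "0 \<le> C * q ^ k * a (\<sigma> * 2 ^ k)" if "0 < \<sigma>" for k \<sigma>
    using that C q a0 B by (auto intro!: mult_left_mono)
  \<comment> \<open>Dominated convergence for series. For fixed \<open>k\<close> the radius
    \<open>\<sigma> * 2 ^ k\<close> shrinks to 0, but for fixed \<sigma> it is unbounded in
    \<open>k\<close>, so the dominating series relies on the bound \<open>B\<close> at all
    radii.\<close>
  have "((\<lambda>\<sigma>. \<Sum>k. C * q ^ k * a (\<sigma> * 2 ^ k)) \<longlongrightarrow> (\<Sum>k. 0)) (at_right 0)"
  proof (rule tannerys_theorem[THEN conjunct2, THEN conjunct2])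
    show "((\<lambda>\<sigma>. C * q ^ k * a (\<sigma> * 2 ^ k)) \<longlongrightarrow> 0) (at_right 0)" for k
    proof (intro tendsto_mult_right_zero filterlim_compose[OF lim])
      have "((\<lambda>\<sigma>::real. \<sigma> * 2 ^ k) \<longlongrightarrow> 0 * 2 ^ k) (at_right 0)" by (intro tendsto_intros)
      moreover have "\<forall>\<^sub>F \<sigma> in at_right (0::real). \<sigma> * 2 ^ k \<in> {0<..} \<and> \<sigma> * 2 ^ k \<noteq> 0"
        using pos by eventually_elim auto
      ultimately show "filterlim (\<lambda>\<sigma>::real. \<sigma> * 2 ^ k) (at_right 0) (at_right 0)"
        by (auto simp: filterlim_at)
    qed
    have "\<forall>\<^sub>F (k, \<sigma>) in at_top \<times>\<^sub>F at_right 0. norm (C * q ^ k * a (\<sigma> * 2 ^ k)) \<le> C * q ^ k * B"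
      unfolding eventually_prod_filter
      using pos le by (intro exI[of _ "\<lambda>_. True"] exI[of _ "\<lambda>\<sigma>. 0 < \<sigma>"]) auto
    then show "\<forall>\<^sub>F (k, \<sigma>) in at_top \<times>\<^sub>F at_right 0. norm (C * q ^ k * a (\<sigma> * 2 ^ k)) \<le> C * q ^ k * B" .
  qed (use summ in auto)
  then have "((\<lambda>\<sigma>. \<Sum>k. C * q ^ k * a (\<sigma> * 2 ^ k)) \<longlongrightarrow> 0) (at_right 0)" by simp
  then have up: "((\<lambda>\<sigma>. ennreal (\<Sum>k. C * q ^ k * a (\<sigma> * 2 ^ k))) \<longlongrightarrow> 0) (at_right 0)"
    using tendsto_ennrealI by fastforce
  show ?thesis
  proof (rule tendsto_sandwich[OF _ _ tendsto_const up])
    show "\<forall>\<^sub>F \<sigma> in at_right 0. (\<integral>\<^sup>+w. ennreal \<bar>\<phi> w\<bar> * ennreal (D (\<sigma> * w)) \<partial>lborel) \<le>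
        ennreal (\<Sum>k. C * q ^ k * a (\<sigma> * 2 ^ k))"
      using pos
    proof eventually_elim
      fix \<sigma> :: real assume \<sigma>: "0 < \<sigma>"
      \<comment> \<open>Substituting \<open>t = \<sigma> * w\<close>, the Jacobian \<sigma> cancels
        against the factor \<sigma> of the radius \<open>\<sigma> * R\<close>.\<close>
      have scale: "(\<integral>\<^sup>+w\<in>{- R..R}. ennreal (D (\<sigma> * w)) \<partial>lborel) \<le> ennreal (R * a (\<sigma> * R))" if "0 < R" for R
      proof -
        have "ennreal \<sigma> * (\<integral>\<^sup>+w\<in>{- R..R}. ennreal (D (\<sigma> * w)) \<partial>lborel) =
            (\<integral>\<^sup>+t\<in>{- (\<sigma> * R)..\<sigma> * R}. ennreal (D t) \<partial>lborel)"
        proof -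
          have ind: "indicator {- (\<sigma> * R)..\<sigma> * R} (\<sigma> * w) = (indicator {- R..R} w :: ennreal)" for w
            using \<sigma> mult_le_cancel_left_pos[OF \<sigma>, of "- R" w] mult_le_cancel_left_pos[OF \<sigma>, of w R]
            by (simp add: indicator_def)
          have "(\<integral>\<^sup>+t\<in>{- (\<sigma> * R)..\<sigma> * R}. ennreal (D t) \<partial>lborel) =
              ennreal \<bar>\<sigma>\<bar> * (\<integral>\<^sup>+w. ennreal (D (0 + \<sigma> * w)) * indicator {- (\<sigma> * R)..\<sigma> * R} (0 + \<sigma> * w) \<partial>lborel)"
            using \<sigma> by (intro nn_integral_real_affine) auto
          then show ?thesis using \<sigma> by (simp add: ind)
        qed
        also have "\<dots> \<le> ennreal (\<sigma> * R * a (\<sigma> * R))" using \<sigma> that by (intro D) auto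
        also have "\<dots> = ennreal \<sigma> * ennreal (R * a (\<sigma> * R))"
          using \<sigma> by (simp add: ennreal_mult'[symmetric] mult.assoc)
        finally show ?thesis
          using \<sigma> by (subst (asm) ennreal_mult_le_mult_iff) auto
      qed
      have "(\<integral>\<^sup>+w. ennreal \<bar>\<phi> w\<bar> * ennreal (D (\<sigma> * w)) \<partial>lborel) \<le>
          (\<Sum>k. ennreal (C * (2 powr (- \<beta>)) ^ k) * (\<integral>\<^sup>+w\<in>{- (2 ^ k)..2 ^ k}. ennreal (D (\<sigma> * w)) \<partial>lborel))"
        unfolding C_def using K \<beta> \<phi> by (intro dyadic_majorant) auto
      also have "\<dots> \<le> (\<Sum>k. ennreal (C * (2 powr (- \<beta>)) ^ k) * ennreal (2 ^ k * a (\<sigma> * 2 ^ k)))"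
        by (intro suminf_le mult_left_mono scale) auto
      also have "\<dots> = (\<Sum>k. ennreal (C * q ^ k * a (\<sigma> * 2 ^ k)))"
        using C by (intro suminf_cong) (simp add: ennreal_mult'[symmetric] q_def power_mult_distrib mult_ac)
      also have "\<dots> = ennreal (\<Sum>k. C * q ^ k * a (\<sigma> * 2 ^ k))"
        using le[OF \<sigma>] by (intro suminf_ennreal2 summable_comparison_test'[OF summ]) auto
      finally show "(\<integral>\<^sup>+w. ennreal \<bar>\<phi> w\<bar> * ennreal (D (\<sigma> * w)) \<partial>lborel) \<le>
        ennreal (\<Sum>k. C * q ^ k * a (\<sigma> * 2 ^ k))" .
    qed
  qed auto
qed

section \<open>Convolutions at a Lebesgue point\<close>

text \<open>The evaluation point moves with \<sigma>. Substituting \<open>z = z\<^sub>0 + w\<close>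
  turns the argument of \<open>g\<close> into \<open>x - \<sigma> * w\<close>, so the error is at
  most the integral of \<open>\<bar>\<psi> (z\<^sub>0 + w)\<bar> * \<bar>g (x - \<sigma> * w) - g
  x\<bar>\<close>, a concentrating kernel with a fixed shift.\<close>

lemma tendsto_convolution_lebesgue_point:
  fixes \<psi> g :: "real \<Rightarrow> real" and x z\<^sub>0 :: real
  assumes [measurable]: "\<psi> \<in> borel_measurable borel" and K: "0 \<le> K" and \<beta>: "1 < \<beta>"
    and \<psi>: "\<And>z. \<bar>\<psi> z\<bar> \<le> K * max 1 \<bar>z\<bar> powr (- \<beta>)"
    and g: "integrable lborel g"
    and leb: "((\<lambda>h. (LINT t:{x-h..x+h}|lborel. \<bar>g t - g x\<bar>) / h) \<longlongrightarrow> 0) (at_right 0)"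
  shows "((\<lambda>\<sigma>. \<integral>z. \<psi> z * g (x + \<sigma> * z\<^sub>0 - \<sigma> * z) \<partial>lborel) \<longlongrightarrow> g x * (\<integral>z. \<psi> z \<partial>lborel)) (at_right 0)"
proof -
  have [measurable]: "g \<in> borel_measurable borel" using g by auto
  define D where "D t = \<bar>g (x - t) - g x\<bar>" for t
  have [measurable]: "D \<in> borel_measurable borel" unfolding D_def by measurable
  define A where "A r = (LINT t:{x-r..x+r}|lborel. \<bar>g t - g x\<bar>)" for r
  define a where "a r = A r / r" for r
  have gI: "set_integrable lborel {p..q} g" for p q
    using g unfolding set_integrable_def by (intro integrable_mult_indicator) auto
  have int: "set_integrable lborel {p..q} (\<lambda>t. \<bar>g t - c\<bar>)" for p q c
    by (intro set_integrable_abs_diff_const gI)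
  have A0: "0 \<le> A r" for r
    unfolding A_def set_lebesgue_integral_def by (intro integral_nonneg_AE) auto
  have DA: "(\<integral>\<^sup>+t\<in>{- r..r}. ennreal (D t) \<partial>lborel) = ennreal (A r)" for r
  proof -
    have "ennreal (A r) = (\<integral>\<^sup>+t. ennreal (indicator {x-r..x+r} t * \<bar>g t - g x\<bar>) \<partial>lborel)"
      using int unfolding A_def set_lebesgue_integral_def set_integrable_def
      by (subst nn_integral_eq_integral) auto
    also have "\<dots> = ennreal \<bar>-1\<bar> * (\<integral>\<^sup>+t. ennreal (indicator {x-r..x+r} (x + (-1) * t) * \<bar>g (x + (-1) * t) - g x\<bar>) \<partial>lborel)"
      by (intro nn_integral_real_affine) auto
    also have "\<dots> = (\<integral>\<^sup>+t\<in>{- r..r}. ennreal (D t) \<partial>lborel)"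
      by (auto simp: D_def indicator_def intro!: nn_integral_cong)
    finally show ?thesis ..
  qed
  have alim: "(a \<longlongrightarrow> 0) (at_right 0)" using leb unfolding a_def A_def .
  then have "\<forall>\<^sub>F r in at_right 0. a r < 1" by (rule order_tendstoD) simp
  then obtain \<delta> where \<delta>: "0 < \<delta>" "\<And>r. 0 < r \<Longrightarrow> r < \<delta> \<Longrightarrow> a r < 1"
    by (auto simp: eventually_at_right_field)
  define G where "G = (\<integral>t. \<bar>g t\<bar> \<partial>lborel)"
  have G0: "0 \<le> G" unfolding G_def by simp
  \<comment> \<open>Small radii are controlled by the Lebesgue point, large ones by integrability of
    \<open>g\<close>: there \<open>a r \<le> G / r + 2 * \<bar>g x\<bar>\<close>.\<close>
  have B: "a r \<le> 1 + G / \<delta> + 2 * \<bar>g x\<bar>" if "0 < r" for r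
  proof (cases "r < \<delta>")
    case True
    have "0 \<le> G / \<delta>" using G0 \<delta>(1) by simp
    then show ?thesis using \<delta>(2)[OF that True] by linarith
  next
    case False
    have cI: "set_integrable lborel {x-r..x+r} (\<lambda>t. \<bar>g x\<bar>)"
      by (intro borel_integrable_atLeastAtMost') auto
    have "A r \<le> (LINT t:{x-r..x+r}|lborel. \<bar>g t\<bar> + \<bar>g x\<bar>)"
      unfolding A_def by (intro set_integral_mono int set_integral_add set_integrable_abs gI cI) auto
    also have "\<dots> = (LINT t:{x-r..x+r}|lborel. \<bar>g t\<bar>) + 2 * r * \<bar>g x\<bar>"
      using that by (subst set_integral_add(2)[OF set_integrable_abs[OF gI] cI]) (simp add: set_lebesgue_integral_def)
    also have "(LINT t:{x-r..x+r}|lborel. \<bar>g t\<bar>) \<le> G"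
      unfolding G_def set_lebesgue_integral_def using g
      by (intro integral_mono integrable_mult_indicator[where 'b=real] integrable_abs) (auto simp: indicator_def)
    finally have "a r \<le> (G + 2 * r * \<bar>g x\<bar>) / r" unfolding a_def using that by (simp add: divide_right_mono)
    also have "\<dots> = G / r + 2 * \<bar>g x\<bar>" using that by (simp add: field_simps)
    also have "G / r \<le> G / \<delta>" using False G0 \<delta> by (intro divide_left_mono) auto
    finally show ?thesis by simp
  qed
  \<comment> \<open>Shifting the kernel changes \<open>max 1 \<bar>w\<bar>\<close> by a factor of at
    most \<open>1 + \<bar>z\<^sub>0\<bar>\<close>. The decay exponent survives, and the constant
    grows by the power \<beta> of that factor.\<close>
  define K' where "K' = K * (1 + \<bar>z\<^sub>0\<bar>) powr \<beta>"
  have \<phi>: "\<bar>\<psi> (z\<^sub>0 + w)\<bar> \<le> K' * max 1 \<bar>w\<bar> powr (- \<beta>)" for w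
  proof -
    have "\<bar>w\<bar> \<le> \<bar>z\<^sub>0 + w\<bar> + \<bar>z\<^sub>0\<bar>" by linarith
    also have "\<dots> \<le> max 1 \<bar>z\<^sub>0 + w\<bar> + \<bar>z\<^sub>0\<bar> * max 1 \<bar>z\<^sub>0 + w\<bar>"
      using mult_left_mono[of 1 "max 1 \<bar>z\<^sub>0 + w\<bar>" "\<bar>z\<^sub>0\<bar>"] by (intro add_mono) auto
    finally have "\<bar>w\<bar> \<le> (1 + \<bar>z\<^sub>0\<bar>) * max 1 \<bar>z\<^sub>0 + w\<bar>" by (simp add: distrib_right)
    moreover have "1 * 1 \<le> (1 + \<bar>z\<^sub>0\<bar>) * max 1 \<bar>z\<^sub>0 + w\<bar>" by (intro mult_mono) auto
    ultimately have "max 1 \<bar>w\<bar> \<le> (1 + \<bar>z\<^sub>0\<bar>) * max 1 \<bar>z\<^sub>0 + w\<bar>" by simp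
    then have "((1 + \<bar>z\<^sub>0\<bar>) * max 1 \<bar>z\<^sub>0 + w\<bar>) powr (- \<beta>) \<le> max 1 \<bar>w\<bar> powr (- \<beta>)"
      using \<beta> by (intro powr_mono2') auto
    moreover have "1 + \<bar>z\<^sub>0\<bar> \<noteq> 0" by linarith
    ultimately have "max 1 \<bar>z\<^sub>0 + w\<bar> powr (- \<beta>) \<le> (1 + \<bar>z\<^sub>0\<bar>) powr \<beta> * max 1 \<bar>w\<bar> powr (- \<beta>)"
      using mult_left_mono[of "((1 + \<bar>z\<^sub>0\<bar>) * max 1 \<bar>z\<^sub>0 + w\<bar>) powr (- \<beta>)"
        "max 1 \<bar>w\<bar> powr (- \<beta>)" "(1 + \<bar>z\<^sub>0\<bar>) powr \<beta>"]
      by (simp add: powr_mult mult.assoc[symmetric] powr_add[symmetric])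
    from mult_left_mono[OF this K] \<psi>[of "z\<^sub>0 + w"] show ?thesis by (simp add: K'_def mult.assoc)
  qed
  have lim: "((\<lambda>\<sigma>. \<integral>\<^sup>+w. ennreal \<bar>\<psi> (z\<^sub>0 + w)\<bar> * ennreal (D (\<sigma> * w)) \<partial>lborel) \<longlongrightarrow> 0) (at_right 0)"
  proof (rule tendsto_nn_integral_concentrating[OF _ _ \<beta> \<phi> _ _ B alim])
    show "0 \<le> K'" using K by (simp add: K'_def)
    show "(\<integral>\<^sup>+t\<in>{- r..r}. ennreal (D t) \<partial>lborel) \<le> ennreal (r * a r)" if "0 < r" for r
      using that by (simp add: DA a_def)
  qed (use A0 in \<open>auto simp: a_def\<close>)
  have \<psi>I: "integrable lborel \<psi>" using K \<beta> \<psi> by (intro powr_tail_lborel_integrable) auto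
  \<comment> \<open>As \<open>g\<close> is integrable but possibly unbounded, integrability of the
    product with \<psi> comes from boundedness of \<psi>.\<close>
  have \<psi>K: "\<bar>\<psi> z\<bar> \<le> K" for z
  proof -
    have "max 1 \<bar>z\<bar> powr (- \<beta>) \<le> max 1 \<bar>z\<bar> powr 0" using \<beta> by (intro powr_mono) auto
    also have "\<dots> = 1" by (auto simp: max_def)
    finally have "max 1 \<bar>z\<bar> powr (- \<beta>) \<le> 1" .
    from mult_left_mono[OF this K] \<psi>[of z] show ?thesis by simp
  qed
  have "((\<lambda>\<sigma>. ennreal \<bar>(\<integral>z. \<psi> z * g (x + \<sigma> * z\<^sub>0 - \<sigma> * z) \<partial>lborel) - g x * (\<integral>z. \<psi> z \<partial>lborel)\<bar>) \<longlongrightarrow> 0) (at_right 0)"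
  proof (rule tendsto_sandwich[OF _ _ tendsto_const lim])
    show "\<forall>\<^sub>F \<sigma> in at_right 0. ennreal \<bar>(\<integral>z. \<psi> z * g (x + \<sigma> * z\<^sub>0 - \<sigma> * z) \<partial>lborel) - g x * (\<integral>z. \<psi> z \<partial>lborel)\<bar> \<le>
       (\<integral>\<^sup>+w. ennreal \<bar>\<psi> (z\<^sub>0 + w)\<bar> * ennreal (D (\<sigma> * w)) \<partial>lborel)"
      using eventually_at_right_less
    proof eventually_elim
      fix \<sigma> :: real assume \<sigma>: "0 < \<sigma>"
      let ?g = "\<lambda>z. g (x + \<sigma> * z\<^sub>0 - \<sigma> * z)"
      have "integrable lborel ?g"
        using lborel_integrable_real_affine[OF g, of "- \<sigma>" "x + \<sigma> * z\<^sub>0"] \<sigma> by simp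
      then have "integrable lborel (\<lambda>z. K * ?g z)" by simp
      then have I: "integrable lborel (\<lambda>z. \<psi> z * ?g z)"
        by (rule Bochner_Integration.integrable_bound)
           (use \<psi>K K in \<open>auto simp: abs_mult intro!: mult_right_mono\<close>)
      have I2: "integrable lborel (\<lambda>z. \<psi> z * g x)" using \<psi>I by simp
      have eq: "(\<integral>z. \<psi> z * ?g z \<partial>lborel) - g x * (\<integral>z. \<psi> z \<partial>lborel) = (\<integral>z. \<psi> z * ?g z - \<psi> z * g x \<partial>lborel)"
        by (subst Bochner_Integration.integral_diff[OF I I2]) simp
      have "ennreal \<bar>(\<integral>z. \<psi> z * ?g z \<partial>lborel) - g x * (\<integral>z. \<psi> z \<partial>lborel)\<bar> \<le>
          (\<integral>\<^sup>+z. ennreal \<bar>\<psi> z * ?g z - \<psi> z * g x\<bar> \<partial>lborel)"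
        unfolding eq using integral_norm_bound_ennreal[OF Bochner_Integration.integrable_diff[OF I I2]] by simp
      also have "\<dots> = ennreal \<bar>1\<bar> * (\<integral>\<^sup>+w. ennreal \<bar>\<psi> (z\<^sub>0 + 1 * w) * ?g (z\<^sub>0 + 1 * w) - \<psi> (z\<^sub>0 + 1 * w) * g x\<bar> \<partial>lborel)"
        by (intro nn_integral_real_affine) auto
      also have "\<dots> = (\<integral>\<^sup>+w. ennreal \<bar>\<psi> (z\<^sub>0 + w)\<bar> * ennreal (D (\<sigma> * w)) \<partial>lborel)"
        by (auto intro!: nn_integral_cong arg_cong[where f=ennreal]
          simp: D_def ennreal_mult'[symmetric] abs_mult[symmetric] algebra_simps)
      finally show "ennreal \<bar>(\<integral>z. \<psi> z * ?g z \<partial>lborel) - g x * (\<integral>z. \<psi> z \<partial>lborel)\<bar> \<le>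
        (\<integral>\<^sup>+w. ennreal \<bar>\<psi> (z\<^sub>0 + w)\<bar> * ennreal (D (\<sigma> * w)) \<partial>lborel)" .
    qed
  qed auto
  then have "((\<lambda>\<sigma>. ennreal \<bar>(\<integral>z. \<psi> z * g (x + \<sigma> * z\<^sub>0 - \<sigma> * z) \<partial>lborel) - g x * (\<integral>z. \<psi> z \<partial>lborel)\<bar>) \<longlongrightarrow> ennreal 0) (at_right 0)"
    by simp
  then have "((\<lambda>\<sigma>. \<bar>(\<integral>z. \<psi> z * g (x + \<sigma> * z\<^sub>0 - \<sigma> * z) \<partial>lborel) - g x * (\<integral>z. \<psi> z \<partial>lborel)\<bar>) \<longlongrightarrow> 0) (at_right 0)"
    by (rule tendsto_ennrealD) auto
  then show ?thesis by (rule LIM_zero_cancel[OF tendsto_rabs_zero_cancel])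
qed

section \<open>Global tail bounds and the almost sure limit\<close>

text \<open>The dyadic estimate takes a bound on the whole line, not an asymptotic one. Beyond
  \<open>R\<close> the constant of the O-bound serves; inside, the supremum bound \<open>C\<close>
  is written as \<open>C * (R powr \<alpha> * R powr (- \<alpha>))\<close>.\<close>

lemma powr_tail_bound:
  fixes f :: "real \<Rightarrow> real"
  assumes "bounded (range f)" and \<alpha>: "0 \<le> \<alpha>"
    and "f \<in> O[at_infinity](\<lambda>z. \<bar>z\<bar> powr (- \<alpha>))"
  obtains K where "0 \<le> K" "\<And>z. \<bar>f z\<bar> \<le> K * max 1 \<bar>z\<bar> powr (- \<alpha>)"
proof -
  obtain C where C: "\<And>z. \<bar>f z\<bar> \<le> C"
    using assms(1) by (auto simp: bounded_iff)
  then have C0: "0 \<le> C" using abs_ge_zero order_trans by blast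
  obtain c where c: "c > 0" "\<forall>\<^sub>F z in at_infinity. norm (f z) \<le> c * norm (\<bar>z\<bar> powr (- \<alpha>))"
    using landau_o.bigE[OF assms(3)] by blast
  then obtain b where b: "\<And>z. b \<le> \<bar>z\<bar> \<Longrightarrow> \<bar>f z\<bar> \<le> c * \<bar>z\<bar> powr (- \<alpha>)"
    by (auto simp: eventually_at_infinity)
  define R where "R = max 1 b"
  show thesis
  proof (rule that[of "c + C * R powr \<alpha>"])
    show "0 \<le> c + C * R powr \<alpha>" using c C0 by simp
    show "\<bar>f z\<bar> \<le> (c + C * R powr \<alpha>) * max 1 \<bar>z\<bar> powr (- \<alpha>)" for z
    proof (cases "R \<le> \<bar>z\<bar>")
      case True
      then have "1 \<le> \<bar>z\<bar>" "b \<le> \<bar>z\<bar>" by (auto simp: R_def)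
      then have "\<bar>f z\<bar> \<le> c * max 1 \<bar>z\<bar> powr (- \<alpha>)" using b[of z] by (simp add: max_def)
      then show ?thesis using C0 by (simp add: distrib_right add_increasing2)
    next
      case False
      have "\<bar>f z\<bar> \<le> C * (R powr \<alpha> * R powr (- \<alpha>))"
        using C[of z] by (simp add: R_def powr_minus)
      also have "\<dots> \<le> C * (R powr \<alpha> * max 1 \<bar>z\<bar> powr (- \<alpha>))"
        using False \<alpha> C0 by (intro mult_left_mono powr_mono2') (auto simp: R_def)
      finally show ?thesis using c by (simp add: distrib_right add_increasing mult.assoc)
    qed
  qed
qed

theorem theorem3:
  fixes M :: "'a measure" and X Z :: "'a \<Rightarrow> real" and f :: "real \<Rightarrow> real" and \<alpha> :: real
  assumes "prob_space M"
    and "distributed M lborel Z (\<lambda>z. ennreal (f z))"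
    and "\<And>z. 0 \<le> f z"
    and "bounded (range f)"
    and "\<alpha> > 2"
    and "f \<in> O[at_infinity](\<lambda>z. \<bar>z\<bar> powr (- \<alpha>))"
    and "prob_space.indep_var M borel X borel Z"
    and "absolutely_continuous lborel (distr M borel X)"
  shows "AE \<omega> in M. ((\<lambda>\<sigma>. scaled_error M X Z f \<sigma> \<omega>) \<longlongrightarrow>
    prob_space.expectation M Z - Z \<omega>) (at_right 0)"
proof -
  interpret prob_space M by fact
  note dZ = assms(2) and nonneg = assms(3) and bdd = assms(4) and \<alpha> = assms(5) and tail = assms(6)
  have X [measurable]: "random_variable borel X" using assms(7) by (rule indep_var_rv1)
  have "(\<lambda>x. ennreal (f x)) \<in> borel_measurable lborel"
    using dZ by (auto simp: distributed_def)
  then have "(\<lambda>x. enn2real (ennreal (f x))) \<in> borel_measurable borel" by measurable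
  then have f [measurable]: "f \<in> borel_measurable borel" using nonneg by simp
  obtain K where K: "0 \<le> K" and fK: "\<And>z. \<bar>f z\<bar> \<le> K * max 1 \<bar>z\<bar> powr (- \<alpha>)"
    using powr_tail_bound[OF bdd _ tail] \<alpha> by auto
  \<comment> \<open>The factor \<open>z\<close> costs one power of decay. The remaining exponent
    \<open>\<alpha> - 1\<close> exceeds 1 because \<open>\<alpha> > 2\<close>, as the convolution
    lemma demands.\<close>
  have zfK: "\<bar>z * f z\<bar> \<le> K * max 1 \<bar>z\<bar> powr (- (\<alpha> - 1))" for z
  proof -
    have "\<bar>z * f z\<bar> \<le> max 1 \<bar>z\<bar> * (K * max 1 \<bar>z\<bar> powr (- \<alpha>))"
      unfolding abs_mult by (intro mult_mono fK) auto
    also have "\<dots> = K * max 1 \<bar>z\<bar> powr (- (\<alpha> - 1))"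
      by (simp add: powr_diff powr_minus field_simps)
    finally show ?thesis .
  qed
  have f1: "(\<integral>z. f z \<partial>lborel) = 1"
    using distributed_integral[OF dZ, of "\<lambda>_. 1"] nonneg by (simp add: prob_space)
  have EZ: "(\<integral>z. z * f z \<partial>lborel) = expectation Z"
    using distributed_integral[OF dZ, of "\<lambda>z. z"] nonneg by (simp add: mult.commute)
  interpret PX: prob_space "distr M borel X" by (rule prob_space_distr) simp
  \<comment> \<open>A finite nonnegative version of the Radon-Nikodym derivative. Its positivity,
    almost sure under the law of \<open>X\<close>, permits the division by
    \<open>g (X \<omega>)\<close> in the limit.\<close>
  obtain g where g [measurable]: "g \<in> borel_measurable lborel"
    and gRN: "AE x in lborel. RN_deriv lborel (distr M borel X) x = ennreal (g x)"
    and gpos: "AE x in distr M borel X. 0 < g x" and g0: "\<And>x. 0 \<le> g x"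
    using sigma_finite_measure.real_RN_deriv[OF sigma_finite_lborel PX.finite_measure_axioms assms(8)] by auto
  have law: "distr M borel X = density lborel (\<lambda>x. ennreal (g x))"
  proof -
    have "distr M borel X = density lborel (RN_deriv lborel (distr M borel X))"
      using sigma_finite_measure.density_RN_deriv[OF sigma_finite_lborel assms(8)] by simp
    also have "\<dots> = density lborel (\<lambda>x. ennreal (g x))"
      using gRN by (intro density_cong) auto
    finally show ?thesis .
  qed
  have gI: "integrable lborel g"
  proof -
    have "(\<integral>\<^sup>+x. ennreal (g x) \<partial>lborel) = 1"
      using PX.emeasure_space_1 unfolding law by (simp add: emeasure_density)
    then show ?thesis using g0 by (intro integrableI_bounded) auto
  qed
  \<comment> \<open>Substitution \<open>x = y - \<sigma> * z\<close>. The Jacobian \<sigma> is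
    common to the numerator (\<psi> taken as \<open>z * f z\<close>) and the denominator (\<psi>
    taken as \<open>f\<close>), so it cancels in the quotient.\<close>
  have bayes: "expectation (\<lambda>\<omega>. \<psi> ((y - X \<omega>) / \<sigma>)) = \<sigma> * (\<integral>z. \<psi> z * g (y - \<sigma> * z) \<partial>lborel)"
    if [measurable]: "\<psi> \<in> borel_measurable borel" and \<sigma>: "0 < \<sigma>" for \<psi> :: "real \<Rightarrow> real" and y \<sigma>
  proof -
    have "expectation (\<lambda>\<omega>. \<psi> ((y - X \<omega>) / \<sigma>)) = (\<integral>x. \<psi> ((y - x) / \<sigma>) \<partial>distr M borel X)"
      by (subst integral_distr) auto
    also have "\<dots> = (\<integral>x. g x * \<psi> ((y - x) / \<sigma>) \<partial>lborel)"
      unfolding law using g0 by (subst integral_density) auto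
    also have "\<dots> = \<bar>- \<sigma>\<bar> *\<^sub>R (\<integral>z. g (y + (- \<sigma>) * z) * \<psi> ((y - (y + (- \<sigma>) * z)) / \<sigma>) \<partial>lborel)"
      using \<sigma> by (intro lborel_integral_real_affine) auto
    finally show ?thesis using \<sigma> by (simp add: mult.commute)
  qed
  have "AE x in distr M borel X.
      ((\<lambda>h. (LINT t:{x-h..x+h}|lborel. \<bar>g t - g x\<bar>) / h) \<longlongrightarrow> 0) (at_right 0)"
  proof (rule absolutely_continuous_AE[OF _ assms(8)])
    show "AE x in lborel. ((\<lambda>h. (LINT t:{x-h..x+h}|lborel. \<bar>g t - g x\<bar>) / h) \<longlongrightarrow> 0) (at_right 0)"
    proof (rule AE_lebesgue_point)
      show "set_integrable lborel {a..b} g" for a b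
        using gI unfolding set_integrable_def by (intro integrable_mult_indicator) auto
    qed
  qed simp
  with gpos have "AE x in distr M borel X. 0 < g x \<and>
      ((\<lambda>h. (LINT t:{x-h..x+h}|lborel. \<bar>g t - g x\<bar>) / h) \<longlongrightarrow> 0) (at_right 0)" by eventually_elim simp
  \<comment> \<open>The exceptional event depends on \<open>X\<close> and \<open>g\<close> only, not
    on \<sigma>. With \<omega> fixed, the rest is a deterministic limit over the whole continuum of
    \<sigma>.\<close>
  from AE_distrD[OF X this] show ?thesis
  proof eventually_elim
    fix \<omega>
    assume *: "0 < g (X \<omega>) \<and>
      ((\<lambda>h. (LINT t:{X \<omega>-h..X \<omega>+h}|lborel. \<bar>g t - g (X \<omega>)\<bar>) / h) \<longlongrightarrow> 0) (at_right 0)"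
    define y where "y \<sigma> = X \<omega> + \<sigma> * Z \<omega>" for \<sigma>
    define d where "d \<sigma> = (\<integral>z. f z * g (y \<sigma> - \<sigma> * z) \<partial>lborel)" for \<sigma>
    define n where "n \<sigma> = (\<integral>z. (z * f z) * g (y \<sigma> - \<sigma> * z) \<partial>lborel)" for \<sigma>
    have d: "(d \<longlongrightarrow> g (X \<omega>)) (at_right 0)"
      using tendsto_convolution_lebesgue_point[OF f K _ fK gI conjunct2[OF *], of "Z \<omega>"] \<alpha> f1
      by (simp add: d_def[abs_def] y_def)
    have n: "(n \<longlongrightarrow> g (X \<omega>) * expectation Z) (at_right 0)"
      using tendsto_convolution_lebesgue_point[OF _ K _ zfK gI conjunct2[OF *], of "Z \<omega>"] \<alpha> EZ
      by (simp add: n_def[abs_def] y_def)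
    have "((\<lambda>\<sigma>. n \<sigma> / d \<sigma> - Z \<omega>) \<longlongrightarrow> g (X \<omega>) * expectation Z / g (X \<omega>) - Z \<omega>) (at_right 0)"
      using * by (intro tendsto_intros n d) auto
    then have lim: "((\<lambda>\<sigma>. n \<sigma> / d \<sigma> - Z \<omega>) \<longlongrightarrow> expectation Z - Z \<omega>) (at_right 0)"
      using * by simp
    \<comment> \<open>The normalising constant is \<open>\<sigma> * d \<sigma>\<close>. Its
      positivity for small \<sigma> rules out the null-measure case of \<open>cond_law\<close> and
      gives access to the quotient formula for the error.\<close>
    have "\<forall>\<^sub>F \<sigma> in at_right 0. 0 < d \<sigma>" using d * by (intro order_tendstoD(1)) auto
    then have "\<forall>\<^sub>F \<sigma> in at_right 0. n \<sigma> / d \<sigma> - Z \<omega> = scaled_error M X Z f \<sigma> \<omega>"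
      using eventually_at_right_less
    proof eventually_elim
      fix \<sigma> :: real assume \<sigma>: "0 < \<sigma>" and dp: "0 < d \<sigma>"
      have D: "expectation (\<lambda>\<omega>. f ((y \<sigma> - X \<omega>) / \<sigma>)) = \<sigma> * d \<sigma>"
        unfolding d_def using \<sigma> by (intro bayes) auto
      have N: "expectation (\<lambda>\<omega>. (y \<sigma> - X \<omega>) / \<sigma> * f ((y \<sigma> - X \<omega>) / \<sigma>)) = \<sigma> * n \<sigma>"
        unfolding n_def using bayes[of "\<lambda>z. z * f z" \<sigma> "y \<sigma>"] \<sigma> by simp
      have "0 < expectation (\<lambda>\<omega>. f ((y \<sigma> - X \<omega>) / \<sigma>))" unfolding D using \<sigma> dp by simp
      from scaled_error_eq(3)[where X=X and Z=Z and f=f and \<sigma>=\<sigma> and y="y \<sigma>" and \<omega>=\<omega>,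
          OF X f nonneg bdd tail \<alpha> \<sigma> y_def this]
      show "n \<sigma> / d \<sigma> - Z \<omega> = scaled_error M X Z f \<sigma> \<omega>"
        unfolding D N using \<sigma> by simp
    qed
    from Lim_transform_eventually[OF lim this]
    show "((\<lambda>\<sigma>. scaled_error M X Z f \<sigma> \<omega>) \<longlongrightarrow> expectation Z - Z \<omega>) (at_right 0)" .
  qed
qed

end
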